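(* Let $\sigma=(I,J,M)$ be a seed with skew-symmetrizer $\mathbf d=\{d_i\}_{i\in I}$, let $\mu$ be a finite sequence of mutations in directions belonging to $J$, let $\mu(\sigma)$ be the resulting seed and let $\mu(\sigma^\vee)=\mu(\sigma)^\vee$ be the seed obtained by applying the same sequence of mutations to the dual seed $\sigma^\vee=(I,J,-M^T)$. Write $\mu:\mathcal A_\sigma\dashrightarrow\mathcal A_{\mu(\sigma)}$ and $\mu^\vee:\mathcal A_{\sigma^\vee}\dashrightarrow\mathcal A_{\mu(\sigma^\vee)}$ for the corresponding composites of birational mutation maps. Let $\Psi_\sigma:\mathcal A_\sigma\to\mathcal A_{\sigma^\vee}$ and $\Psi_{\mu(\sigma)}:\mathcal A_{\mu(\sigma)}\to\mathcal A_{\mu(\sigma^\vee)}$ be the homomorphisms of tori $(x_i)_{i\in I}\mapsto (x_i^{d_i})_{i\in I}$, and put $\psi_\sigma=\Psi_\sigma^t$, $\psi_{\mu(\sigma)}=\Psi_{\mu(\sigma)}^t$. Then $$(\mu^\vee)^t\circ\psi_\sigma=\psi_{\mu(\sigma)}\circ\mu^t$$ as maps from the cocharacter lattice of $\mathcal A_\sigma$ to the cocharacter lattice of $\mathcal A_{\mu(\sigma^\vee)}$. That is, the tropical comparison maps $\psi_\sigma$ agree for all seeds in a mutation class.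
   Context: A seed $\sigma=(I,J,M)$ consists of a finite set $I$, a subset $J\subset I$ and an integer matrix $M=[M_{ij}]_{i,j\in I}$ which is skew-symmetrizable: there are positive integers $\mathbf d=\{d_i\}_{i\in I}$ (a skew-symmetrizer) with $M_{ij}d_j=-M_{ji}d_i$. The associated torus is $\mathcal A_\sigma=\mathbb G_m^{|I|}$ with coordinates $\{a_i\}_{i\in I}$. Matrix mutation in direction $k$: $\mu_k(M)_{ij}=-M_{ij}$ if $k\in\{i,j\}$, and $\mu_k(M)_{ij}=M_{ij}+\frac12(|M_{ik}|M_{kj}+M_{ik}|M_{kj}|)$ otherwise. The same $\mathbf d$ is a skew-symmetrizer of $\mu_k(M)$. For $k\in J$ the mutated seed is $\sigma_k=\mu_k(\sigma)=(I,J,\mu_k(M))$, together with the birational map $\mu_k:\mathcal A_\sigma\dashrightarrow\mathcal A_{\sigma_k}$ given on coordinates by $\mu_k^*(a_i)=a_i$ for $i\ne k$ and $$\mu_k^*(a_k)=a_k^{-1}\Big(\prod_{M_{jk}>0}a_j^{M_{jk}}+\prod_{M_{jk}<0}a_j^{-M_{jk}}\Big).$$ The (Langlands) dual seed of $\sigma$ is $\sigma^\vee=(I,J,-M^T)$; one has $\mu_k(\sigma)^\vee=\mu_k(\sigma^\vee)$. Tropicalization: for a split torus $S$ let $S^t=\mathrm{Hom}(\mathbb G_m,S)$ be its cocharacter lattice. For a nonzero Laurent polynomial $f=\sum c_\chi\chi$ with all $c_\chi\ge0$ (sum over characters $\chi$ of $S$), $f^t(\xi)=\min_{c_\chi>0}\langle\chi,\xi\rangle$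 for $\xi\in S^t$; for a quotient of two such, $(f/g)^t=f^t-g^t$. A rational map $\phi:S\dashrightarrow S'$ of split tori is positive if all its components are such quotients, and then $\phi^t:S^t\to (S')^t$ is determined by $\langle\chi,\phi^t(\xi)\rangle=(\chi\circ\phi)^t(\xi)$ for all characters $\chi$ of $S'$. In the paper's notation, for the cluster variety obtained by gluing the tori $\mathcal A_\sigma$ along mutation maps, $\mu^t$ is denoted $\mathrm{id}^t$ and $(\mu^\vee)^t$ is denoted $(\mathrm{id}^\vee)^t$. *)

theory Defs
  imports
    "HOL-Library.Poly_Mapping"
    "HOL-Computational_Algebra.Polynomial_Factorial"
begin

section \<open>Characters of split tori\<close>

text \<open>
  A split torus with coordinates \<open>a\<^sub>i\<close>, \<open>i \<in> S\<close>, is represented by its finite index set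
  \<open>S :: 'i set\<close>.  A value of the following type is the Laurent monomial
  \<open>\<Prod>i. a\<^sub>i ^ (exponent \<chi> i)\<close> in finitely many of the coordinates indexed by the whole type;
  the characters of the torus \<open>S\<close> are those involving only coordinates from \<open>S\<close>.  The group
  of characters is written additively.
\<close>

typedef 'i character = "{e :: 'i \<Rightarrow> int. finite {i. e i \<noteq> 0}}"
  morphisms exponent Abs_character
  by (rule exI[of _ "\<lambda>_. 0"]) simp

setup_lifting type_definition_character

instantiation character :: (type) ab_group_add
begin

lift_definition zero_character :: "'a character" is "\<lambda>_. 0" by simp

lift_definition plus_character :: "'a character \<Rightarrow> 'a character \<Rightarrow> 'a character"
  is "\<lambda>e f i. e i + f i"
proof -
  fix e f :: "'a \<Rightarrow> int"
  assume "finite {i. e i \<noteq> 0}" "finite {i. f i \<noteq> 0}"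
  then have "finite ({i. e i \<noteq> 0} \<union> {i. f i \<noteq> 0})" by simp
  then show "finite {i. e i + f i \<noteq> 0}"
    by (rule rev_finite_subset) auto
qed

lift_definition uminus_character :: "'a character \<Rightarrow> 'a character"
  is "\<lambda>e i. - e i" by simp

lift_definition minus_character :: "'a character \<Rightarrow> 'a character \<Rightarrow> 'a character"
  is "\<lambda>e f i. e i - f i"
proof -
  fix e f :: "'a \<Rightarrow> int"
  assume "finite {i. e i \<noteq> 0}" "finite {i. f i \<noteq> 0}"
  then have "finite ({i. e i \<noteq> 0} \<union> {i. f i \<noteq> 0})" by simp
  then show "finite {i. e i - f i \<noteq> 0}"
    by (rule rev_finite_subset) auto
qed

instance
  by standard (transfer; simp add: fun_eq_iff)+

end

text \<open>
  Some translation-invariant linear order on characters (lexicographic, with respect to an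
  arbitrarily chosen well-order of the indices).  Its only purpose is that
  \<^theory>\<open>HOL-Library.Poly_Mapping\<close> then makes the ring of Laurent polynomials an instance of
  \<^class>\<open>idom\<close>, so that its fraction field can be formed.  No later definition refers to it.
\<close>

definition index_order :: "'i rel"
  where "index_order = (SOME r. Well_order r \<and> Field r = UNIV)"

lemma index_order: "Well_order (index_order :: 'i rel)" "Field (index_order :: 'i rel) = UNIV"
  using someI_ex[OF well_ordering[where 'a = 'i]] unfolding index_order_def by auto

lemma index_order_trans:
  "(i, j) \<in> index_order \<Longrightarrow> (j, k) \<in> index_order \<Longrightarrow> (i, k) \<in> index_order"
  using index_order(1)[where 'i = 'a] unfolding order_on_defs by (blast dest: transD)

lemma index_order_antisym:
  "(i, j) \<in> index_order \<Longrightarrow> (j, i) \<in> index_order \<Longrightarrow> i = j"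
  using index_order(1)[where 'i = 'a] unfolding order_on_defs by (blast dest: antisymD)

lemma index_order_least:
  assumes "P (k :: 'i)"
  obtains m where "P m" "\<And>j. (j, m) \<in> index_order \<Longrightarrow> j \<noteq> m \<Longrightarrow> \<not> P j"
proof -
  have "wf (index_order - Id :: 'i rel)"
    using index_order(1) unfolding well_order_on_def by blast
  moreover have "k \<in> Collect P" using assms by simp
  ultimately obtain m where "m \<in> Collect P"
    "\<And>j. (j, m) \<in> index_order - Id \<Longrightarrow> j \<notin> Collect P"
    by (rule wfE_min) blast
  then show ?thesis by (intro that[of m]) auto
qed

lemma index_order_total: "(i, j) \<in> index_order \<or> (j, i) \<in> (index_order :: 'i rel)"
proof -
  have "total_on (UNIV :: 'i set) index_order" "refl_on (UNIV :: 'i set) index_order"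
    using index_order(1)[where 'i = 'i] unfolding order_on_defs index_order(2) by auto
  then show ?thesis by (cases "i = j") (auto simp: total_on_def refl_on_def)
qed

instantiation character :: (type) linorder
begin

definition less_character :: "'a character \<Rightarrow> 'a character \<Rightarrow> bool"
  where "\<chi> < \<chi>' \<longleftrightarrow> (\<exists>k. exponent \<chi> k < exponent \<chi>' k \<and>
    (\<forall>j. (j, k) \<in> index_order \<longrightarrow> j \<noteq> k \<longrightarrow> exponent \<chi> j = exponent \<chi>' j))"

definition less_eq_character :: "'a character \<Rightarrow> 'a character \<Rightarrow> bool"
  where "\<chi> \<le> \<chi>' \<longleftrightarrow> \<chi> < \<chi>' \<or> \<chi> = (\<chi>' :: 'a character)"

instance proof (rule linorder.intro_of_class)
  have lessI: "\<chi> < \<psi>" if "exponent \<chi> k < exponent \<psi> k"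
    "\<And>j. (j, k) \<in> index_order \<Longrightarrow> j \<noteq> k \<Longrightarrow> exponent \<chi> j = exponent \<psi> j"
    for \<chi> \<psi> :: "'a character" and k
    unfolding less_character_def by (rule exI[of _ k]) (simp add: that)
  have irrefl: "\<not> \<chi> < \<chi>" for \<chi> :: "'a character"
    by (simp add: less_character_def)
  have trans: "\<chi> < \<omega>" if less: "\<chi> < \<psi>" "\<psi> < \<omega>" for \<chi> \<psi> \<omega> :: "'a character"
  proof -
    obtain k where k: "exponent \<chi> k < exponent \<psi> k"
      "\<And>j. (j, k) \<in> index_order \<Longrightarrow> j \<noteq> k \<Longrightarrow> exponent \<chi> j = exponent \<psi> j"
      using less(1) unfolding less_character_def by blast
    obtain l where l: "exponent \<psi> l < exponent \<omega> l"
      "\<And>j. (j, l) \<in> index_order \<Longrightarrow> j \<noteq> l \<Longrightarrow> exponent \<psi> j = exponent \<omega> j"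
      using less(2) unfolding less_character_def by blast
    show ?thesis
    proof (cases "(k, l) \<in> index_order")
      case True
      then have "exponent \<chi> k < exponent \<omega> k"
        using k(1) l(1) l(2)[of k] by (cases "k = l") auto
      moreover have "exponent \<chi> j = exponent \<omega> j" if "(j, k) \<in> index_order" "j \<noteq> k" for j
      proof -
        have "(j, l) \<in> index_order" using that(1) True by (rule index_order_trans)
        moreover have "j \<noteq> l" using that True index_order_antisym[of j k] by auto
        ultimately show ?thesis using that k(2) l(2) by simp
      qed
      ultimately show ?thesis by (rule lessI)
    next
      case False
      then have lk: "(l, k) \<in> index_order" "l \<noteq> k"
        using index_order_total[of k l] index_order_total[of k k] by auto
      then have "exponent \<chi> l < exponent \<omega> l" using k(2) l(1) by simp
      moreover have "exponent \<chi> j = exponent \<omega> j" if "(j, l) \<in> index_order" "j \<noteq> l" for j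
      proof -
        have "(j, k) \<in> index_order" using that(1) lk(1) by (rule index_order_trans)
        moreover have "j \<noteq> k" using that lk(1) index_order_antisym[of j l] by auto
        ultimately show ?thesis using that k(2) l(2) by simp
      qed
      ultimately show ?thesis by (rule lessI)
    qed
  qed
  have trichotomy: "\<chi> < \<psi> \<or> \<chi> = \<psi> \<or> \<psi> < \<chi>" for \<chi> \<psi> :: "'a character"
  proof (cases "\<chi> = \<psi>")
    case False
    then have "exponent \<chi> \<noteq> exponent \<psi>" by (simp add: exponent_inject)
    then obtain k where "exponent \<chi> k \<noteq> exponent \<psi> k" by (auto simp: fun_eq_iff)
    then obtain m where m: "exponent \<chi> m \<noteq> exponent \<psi> m"
      "\<And>j. (j, m) \<in> index_order \<Longrightarrow> j \<noteq> m \<Longrightarrow> exponent \<chi> j = exponent \<psi> j"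
      using index_order_least[of "\<lambda>k. exponent \<chi> k \<noteq> exponent \<psi> k"] by metis
    then have "exponent \<chi> m < exponent \<psi> m \<or> exponent \<psi> m < exponent \<chi> m" by linarith
    then show ?thesis using lessI[of \<chi> m \<psi>] lessI[of \<psi> m \<chi>] m(2) by metis
  qed simp
  show "class.linorder ((\<le>) :: 'a character \<Rightarrow> _) (<)"
  proof (rule linorder_strictI, rule order_strictI)
    fix \<chi> \<psi> \<omega> :: "'a character"
    show "\<chi> \<le> \<psi> \<longleftrightarrow> \<chi> < \<psi> \<or> \<chi> = \<psi>" by (rule less_eq_character_def)
    show "\<not> \<chi> < \<chi>" by (rule irrefl)
    show "\<chi> < \<psi> \<or> \<chi> = \<psi> \<or> \<psi> < \<chi>" by (rule trichotomy)
    assume "\<chi> < \<psi>"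
    then show "\<not> \<psi> < \<chi>" using irrefl[of \<chi>] trans[of \<chi> \<psi> \<chi>] by blast
    assume "\<psi> < \<omega>"
    with \<open>\<chi> < \<psi>\<close> show "\<chi> < \<omega>" by (rule trans)
  qed
qed

end

instance character :: (type) linordered_ab_group_add
proof
  fix \<chi> \<psi> \<omega> :: "'a character"
  assume "\<chi> \<le> \<psi>"
  then show "\<omega> + \<chi> \<le> \<omega> + \<psi>"
    by (auto simp: less_eq_character_def less_character_def plus_character.rep_eq)
qed

definition characters :: "'i set \<Rightarrow> 'i character set"
  where "characters S = {\<chi>. \<forall>i. exponent \<chi> i \<noteq> 0 \<longrightarrow> i \<in> S}"

lift_definition coordinate_character :: "'i \<Rightarrow> 'i character"
  is "\<lambda>i j. if j = i then 1 else 0" by simp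

text \<open>
  The cocharacter \<open>t \<mapsto> (t ^ (\<xi> i))\<^sub>i\<close> of the torus \<open>S\<close> is represented by \<open>\<xi>\<close>, set to be \<open>0\<close>
  outside \<open>S\<close>.
\<close>

definition cocharacters :: "'i set \<Rightarrow> ('i \<Rightarrow> int) set"
  where "cocharacters S = {\<xi>. \<forall>i. \<xi> i \<noteq> 0 \<longrightarrow> i \<in> S}"

definition pairing :: "'i set \<Rightarrow> 'i character \<Rightarrow> ('i \<Rightarrow> int) \<Rightarrow> int"
  where "pairing S \<chi> \<xi> = (\<Sum>i\<in>S. exponent \<chi> i * \<xi> i)"


section \<open>Rational functions and rational maps of tori\<close>

type_synonym ('i, 'k) laurent = "'i character \<Rightarrow>\<^sub>0 'k"

type_synonym ('i, 'k) rational_function = "('i, 'k) laurent fract"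

definition laurent_polynomials :: "'i set \<Rightarrow> ('i, 'k::zero) laurent set"
  where "laurent_polynomials S = {f. Poly_Mapping.keys f \<subseteq> characters S}"

definition coordinate :: "'i \<Rightarrow> ('i, 'k::idom) rational_function"
  where "coordinate i = to_fract (Poly_Mapping.single (coordinate_character i) 1)"

text \<open>
  A rational map \<open>\<phi>\<close> from a torus \<open>S\<close> to a torus \<open>S'\<close> is given by its components
  \<open>\<phi> i = a\<^sub>i \<circ> \<phi>\<close>, \<open>i \<in> S'\<close>, which are nonzero rational functions on \<open>S\<close>.
\<close>

type_synonym ('i, 'k) rational_map = "'i \<Rightarrow> ('i, 'k) rational_function"

definition character_pullback ::
    "'i set \<Rightarrow> ('i, 'k::idom) rational_map \<Rightarrow> 'i character \<Rightarrow> ('i, 'k) rational_function"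
  where "character_pullback S' \<phi> \<chi> = (\<Prod>i\<in>S'. \<phi> i powi exponent \<chi> i)"

definition laurent_pullback ::
    "'i set \<Rightarrow> ('i, 'k::idom) rational_map \<Rightarrow> ('i, 'k) laurent \<Rightarrow> ('i, 'k) rational_function"
  where "laurent_pullback S' \<phi> f =
    (\<Sum>\<chi>\<in>Poly_Mapping.keys f.
      to_fract (Poly_Mapping.single 0 (Poly_Mapping.lookup f \<chi>)) * character_pullback S' \<phi> \<chi>)"

text \<open>
  \<open>F \<circ> \<phi>\<close>, for a rational function \<open>F\<close> on \<open>S'\<close> that has a representation as a fraction whose
  denominator does not vanish identically on the image of \<open>\<phi>\<close>.
\<close>

definition pullback ::
    "'i set \<Rightarrow> ('i, 'k::idom) rational_map \<Rightarrow> ('i, 'k) rational_function \<Rightarrow> ('i, 'k) rational_function"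
  where "pullback S' \<phi> F =
    (THE G. \<exists>f\<in>laurent_polynomials S'. \<exists>g\<in>laurent_polynomials S'.
      F = to_fract f / to_fract g \<and> laurent_pullback S' \<phi> g \<noteq> 0 \<and>
      G = laurent_pullback S' \<phi> f / laurent_pullback S' \<phi> g)"

text \<open>The composite \<open>\<phi>' \<circ> \<phi>\<close>, where \<open>S'\<close> is the target of \<open>\<phi>\<close> and the source of \<open>\<phi>'\<close>.\<close>

definition compose ::
    "'i set \<Rightarrow> ('i, 'k::idom) rational_map \<Rightarrow> ('i, 'k) rational_map \<Rightarrow> ('i, 'k) rational_map"
  where "compose S' \<phi>' \<phi> = (\<lambda>i. pullback S' \<phi> (\<phi>' i))"


section \<open>Tropicalization\<close>

definition positive_laurent :: "'i set \<Rightarrow> ('i, 'k::linordered_field) laurent \<Rightarrow> bool"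
  where "positive_laurent S f \<longleftrightarrow>
    f \<in> laurent_polynomials S \<and> f \<noteq> 0 \<and> (\<forall>\<chi>. Poly_Mapping.lookup f \<chi> \<ge> 0)"

definition trop_laurent :: "'i set \<Rightarrow> ('i, 'k::linordered_field) laurent \<Rightarrow> ('i \<Rightarrow> int) \<Rightarrow> int"
  where "trop_laurent S f \<xi> = Min ((\<lambda>\<chi>. pairing S \<chi> \<xi>) ` {\<chi>. Poly_Mapping.lookup f \<chi> > 0})"

definition trop_function ::
    "'i set \<Rightarrow> ('i, 'k::linordered_field) rational_function \<Rightarrow> ('i \<Rightarrow> int) \<Rightarrow> int"
  where "trop_function S F \<xi> =
    (THE v. \<exists>f g. positive_laurent S f \<and> positive_laurent S g \<and>
      F = to_fract f / to_fract g \<and> v = trop_laurent S f \<xi> - trop_laurent S g \<xi>)"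

definition tropicalization ::
    "'i set \<Rightarrow> 'i set \<Rightarrow> ('i, 'k::linordered_field) rational_map \<Rightarrow> ('i \<Rightarrow> int) \<Rightarrow> ('i \<Rightarrow> int)"
  where "tropicalization S S' \<phi> \<xi> =
    (THE \<eta>. \<eta> \<in> cocharacters S' \<and>
      (\<forall>\<chi>\<in>characters S'. pairing S' \<chi> \<eta> = trop_function S (character_pullback S' \<phi> \<chi>) \<xi>))"


section \<open>Seeds and mutations\<close>

record 'i seed =
  indices :: "'i set"
  directions :: "'i set"
  exchange_matrix :: "'i \<Rightarrow> 'i \<Rightarrow> int"

definition skew_symmetrizer :: "'i seed \<Rightarrow> ('i \<Rightarrow> int) \<Rightarrow> bool"
  where "skew_symmetrizer \<sigma> d \<longleftrightarrow>
    (\<forall>i\<in>indices \<sigma>. d i > 0) \<and>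
    (\<forall>i\<in>indices \<sigma>. \<forall>j\<in>indices \<sigma>.
      exchange_matrix \<sigma> i j * d j = - (exchange_matrix \<sigma> j i * d i))"

definition is_seed :: "'i seed \<Rightarrow> bool"
  where "is_seed \<sigma> \<longleftrightarrow>
    finite (indices \<sigma>) \<and> directions \<sigma> \<subseteq> indices \<sigma> \<and> (\<exists>d. skew_symmetrizer \<sigma> d)"

definition dual :: "'i seed \<Rightarrow> 'i seed"
  where "dual \<sigma> = \<sigma>\<lparr>exchange_matrix := \<lambda>i j. - exchange_matrix \<sigma> j i\<rparr>"

text \<open>The division by 2 is exact.\<close>

definition matrix_mutation :: "'i \<Rightarrow> ('i \<Rightarrow> 'i \<Rightarrow> int) \<Rightarrow> 'i \<Rightarrow> 'i \<Rightarrow> int"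
  where "matrix_mutation k M i j =
    (if k = i \<or> k = j then - M i j
     else M i j + (\<bar>M i k\<bar> * M k j + M i k * \<bar>M k j\<bar>) div 2)"

definition mutate :: "'i \<Rightarrow> 'i seed \<Rightarrow> 'i seed"
  where "mutate k \<sigma> = \<sigma>\<lparr>exchange_matrix := matrix_mutation k (exchange_matrix \<sigma>)\<rparr>"

definition mutation :: "'i \<Rightarrow> 'i seed \<Rightarrow> ('i, 'k::idom) rational_map"
  where "mutation k \<sigma> = (\<lambda>i.
    if i = k then
      inverse (coordinate k) *
        ((\<Prod>j | j \<in> indices \<sigma> \<and> exchange_matrix \<sigma> j k > 0.
            coordinate j powi exchange_matrix \<sigma> j k) +
         (\<Prod>j | j \<in> indices \<sigma> \<and> exchange_matrix \<sigma> j k < 0.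
            coordinate j powi (- exchange_matrix \<sigma> j k)))
    else coordinate i)"

text \<open>Sequences of mutations; the head of the list is the direction mutated first.\<close>

primrec mutate_seq :: "'i list \<Rightarrow> 'i seed \<Rightarrow> 'i seed"
  where
    "mutate_seq [] \<sigma> = \<sigma>"
  | "mutate_seq (k # ks) \<sigma> = mutate_seq ks (mutate k \<sigma>)"

primrec mutation_seq :: "'i list \<Rightarrow> 'i seed \<Rightarrow> ('i, 'k::idom) rational_map"
  where
    "mutation_seq [] \<sigma> = coordinate"
  | "mutation_seq (k # ks) \<sigma> =
      compose (indices (mutate k \<sigma>)) (mutation_seq ks (mutate k \<sigma>)) (mutation k \<sigma>)"

text \<open>The homomorphism \<open>(x\<^sub>i) \<mapsto> (x\<^sub>i ^ (d i))\<close>.\<close>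

definition power_map :: "('i \<Rightarrow> int) \<Rightarrow> ('i, 'k::idom) rational_map"
  where "power_map d = (\<lambda>i. coordinate i powi d i)"

lemma even_mutation_term: "even (\<bar>a\<bar> * b + a * \<bar>b\<bar>)" for a b :: int
  by (auto simp: abs_if)

lemma mutate_dual: "mutate k (dual \<sigma>) = dual (mutate k \<sigma>)"
proof -
  have "matrix_mutation k (\<lambda>i j. - M j i) i j = - matrix_mutation k M j i"
    for M :: "'a \<Rightarrow> 'a \<Rightarrow> int" and i j
  proof -
    have "(\<bar>M k i\<bar> * - M j k + - M k i * \<bar>M j k\<bar>) div 2
        = (- (\<bar>M j k\<bar> * M k i + M j k * \<bar>M k i\<bar>)) div 2"
      by (simp add: algebra_simps)
    also have "\<dots> = - ((\<bar>M j k\<bar> * M k i + M j k * \<bar>M k i\<bar>) div 2)"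
      using even_mutation_term[of "M j k" "M k i"] by (rule dvd_neg_div)
    finally show ?thesis by (auto simp: matrix_mutation_def)
  qed
  then have "matrix_mutation k (\<lambda>i j. - M j i) = (\<lambda>i j. - matrix_mutation k M j i)"
    for M :: "'a \<Rightarrow> 'a \<Rightarrow> int"
    by (intro ext)
  then show ?thesis by (simp add: mutate_def dual_def)
qed

lemma mutate_seq_dual: "mutate_seq ks (dual \<sigma>) = dual (mutate_seq ks \<sigma>)"
  by (induction ks arbitrary: \<sigma>) (simp_all add: mutate_dual)

end

theory Submission
  imports Defs
begin

text \<open>
  Tropicalization is functorial on positive maps, so the tropical mutation sequence
  \<open>\<mu>\<^sup>t\<close> is the composite of the piecewise-linear maps
  \<open>\<xi>\<^sub>k \<mapsto> - \<xi>\<^sub>k + min (\<Sum>\<^sub>j [M\<^sub>j\<^sub>k]\<^sub>+ \<xi>\<^sub>j) (\<Sum>\<^sub>j [- M\<^sub>j\<^sub>k]\<^sub>+ \<xi>\<^sub>j)\<close>,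
  and \<open>\<psi>\<close> is the linear map \<open>\<xi>\<^sub>i \<mapsto> d\<^sub>i \<xi>\<^sub>i\<close>.  It then suffices to treat one mutation.
  The dual matrix \<open>M\<^sup>\<vee>\<^sub>j\<^sub>k = - M\<^sub>k\<^sub>j\<close> satisfies \<open>M\<^sup>\<vee>\<^sub>j\<^sub>k d\<^sub>j = d\<^sub>k M\<^sub>j\<^sub>k\<close>.  As \<open>d\<close> is positive,
  \<open>M\<^sup>\<vee>\<^sub>j\<^sub>k\<close> and \<open>M\<^sub>j\<^sub>k\<close> have the same sign, and substituting \<open>d\<^sub>j \<xi>\<^sub>j\<close> for \<open>\<xi>\<^sub>j\<close> in the dual
  formula multiplies both arguments of the minimum by the positive number \<open>d\<^sub>k\<close>
  (\<open>trop_mutation_dual\<close>).  Since \<open>d\<close> still symmetrizes the mutated seed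
  (\<open>skew_symmetrizer_mutate\<close>), the general case follows by induction on the sequence.

  The bulk of the work is functoriality.  The idea is to record that a rational function is
  positive together with its tropical value at a fixed point, in one relation
  \<open>trop_value S \<xi> F v\<close>.  It determines \<open>v\<close> because tropicalization is additive on products of
  positive Laurent polynomials: coefficients cannot cancel, so the exponents of a product are
  exactly the sums of the exponents of the factors.  The relation is closed under sums,
  products, inverses and pullback along positive maps (\<open>trop_value_pullback\<close>).  For pullbacks
  one also needs that the value does not depend on the chosen fraction, which holds because
  substitution into Laurent polynomials is multiplicative (\<open>laurent_pullback_mult\<close>).
\<close>

section \<open>Multiplication of Laurent polynomials\<close>

lemma poly_mapping_eq_sum_single:
  "f = (\<Sum>a\<in>Poly_Mapping.keys f. Poly_Mapping.single a (Poly_Mapping.lookup f a))"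
proof (rule poly_mapping_eqI)
  fix k
  have "Poly_Mapping.lookup (\<Sum>a\<in>Poly_Mapping.keys f. Poly_Mapping.single a (Poly_Mapping.lookup f a)) k
      = (\<Sum>a\<in>Poly_Mapping.keys f. if a = k then Poly_Mapping.lookup f a else 0)"
    by (simp add: lookup_sum lookup_single when_def)
  also have "\<dots> = Poly_Mapping.lookup f k"
    by (simp add: sum.delta in_keys_iff)
  finally show "Poly_Mapping.lookup f k =
      Poly_Mapping.lookup (\<Sum>a\<in>Poly_Mapping.keys f. Poly_Mapping.single a (Poly_Mapping.lookup f a)) k"
    by simp
qed

lemma poly_mapping_mult_eq_sum_single:
  fixes f g :: "'a::comm_monoid_add \<Rightarrow>\<^sub>0 'b::comm_semiring_1"
  shows "f * g = (\<Sum>a\<in>Poly_Mapping.keys f. \<Sum>b\<in>Poly_Mapping.keys g.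
    Poly_Mapping.single (a + b) (Poly_Mapping.lookup f a * Poly_Mapping.lookup g b))"
proof -
  have "f * g =
      (\<Sum>a\<in>Poly_Mapping.keys f. Poly_Mapping.single a (Poly_Mapping.lookup f a)) *
      (\<Sum>b\<in>Poly_Mapping.keys g. Poly_Mapping.single b (Poly_Mapping.lookup g b))"
    using poly_mapping_eq_sum_single[of f] poly_mapping_eq_sum_single[of g] by simp
  then show ?thesis by (simp only: sum_product mult_single)
qed

lemma lookup_mult_nonneg:
  fixes f g :: "'a::comm_monoid_add \<Rightarrow>\<^sub>0 'k::linordered_field"
  assumes "\<forall>a. Poly_Mapping.lookup f a \<ge> 0" "\<forall>b. Poly_Mapping.lookup g b \<ge> 0"
  shows "Poly_Mapping.lookup (f * g) c \<ge> 0"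
  unfolding poly_mapping_mult_eq_sum_single lookup_sum lookup_single when_def
  using assms by (intro sum_nonneg) simp

text \<open>
  Nonnegative coefficients cannot cancel: the coefficient of the product at \<open>a + b\<close> is a sum
  of nonnegative terms, one of which, coming from \<open>a\<close> and \<open>b\<close> themselves, is positive.
\<close>

lemma keys_mult_nonneg:
  fixes f g :: "'a::comm_monoid_add \<Rightarrow>\<^sub>0 'k::linordered_field"
  assumes f: "\<forall>a. Poly_Mapping.lookup f a \<ge> 0" and g: "\<forall>b. Poly_Mapping.lookup g b \<ge> 0"
  shows "Poly_Mapping.keys (f * g) = (\<lambda>(a, b). a + b) ` (Poly_Mapping.keys f \<times> Poly_Mapping.keys g)"
proof
  show "Poly_Mapping.keys (f * g) \<subseteq> (\<lambda>(a, b). a + b) ` (Poly_Mapping.keys f \<times> Poly_Mapping.keys g)"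
    using keys_mult[of f g] by fastforce
  show "(\<lambda>(a, b). a + b) ` (Poly_Mapping.keys f \<times> Poly_Mapping.keys g) \<subseteq> Poly_Mapping.keys (f * g)"
  proof clarify
    fix a b
    assume a: "a \<in> Poly_Mapping.keys f" and b: "b \<in> Poly_Mapping.keys g"
    let ?t = "\<lambda>x y. if x + y = a + b then Poly_Mapping.lookup f x * Poly_Mapping.lookup g y else 0"
    have t: "?t x y \<ge> 0" for x y using f g by simp
    have "0 < ?t a b"
      using a b f g by (simp add: in_keys_iff order_less_le)
    also have "\<dots> \<le> (\<Sum>y\<in>Poly_Mapping.keys g. ?t a y)"
      using b t by (intro member_le_sum) auto
    also have "\<dots> \<le> (\<Sum>x\<in>Poly_Mapping.keys f. \<Sum>y\<in>Poly_Mapping.keys g. ?t x y)"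
      using a t by (intro member_le_sum[of a _ "\<lambda>x. \<Sum>y\<in>Poly_Mapping.keys g. ?t x y"] sum_nonneg) auto
    also have "\<dots> = Poly_Mapping.lookup (f * g) (a + b)"
      unfolding poly_mapping_mult_eq_sum_single[of f g] by (simp add: lookup_sum lookup_single when_def)
    finally show "a + b \<in> Poly_Mapping.keys (f * g)" by (simp add: in_keys_iff)
  qed
qed


section \<open>Positive Laurent polynomials\<close>

lemma characters_zero: "0 \<in> characters S"
  by (simp add: characters_def zero_character.rep_eq)

lemma characters_add: "\<chi> \<in> characters S \<Longrightarrow> \<chi>' \<in> characters S \<Longrightarrow> \<chi> + \<chi>' \<in> characters S"
  unfolding characters_def by (auto simp: plus_character.rep_eq) force

lemma coordinate_character_in_characters: "i \<in> S \<Longrightarrow> coordinate_character i \<in> characters S"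
  by (auto simp: characters_def coordinate_character.rep_eq)

lemma pairing_zero [simp]: "pairing S 0 \<xi> = 0"
  by (simp add: pairing_def zero_character.rep_eq)

lemma pairing_add: "pairing S (\<chi> + \<chi>') \<xi> = pairing S \<chi> \<xi> + pairing S \<chi>' \<xi>"
  by (simp add: pairing_def plus_character.rep_eq distrib_right sum.distrib)

lemma pairing_coordinate_character:
  "finite S \<Longrightarrow> i \<in> S \<Longrightarrow> pairing S (coordinate_character i) \<xi> = \<xi> i"
  by (simp add: pairing_def coordinate_character.rep_eq if_distrib[of "\<lambda>x. x * _"] cong: if_cong)

lemma positive_laurent_single:
  "\<chi> \<in> characters S \<Longrightarrow> c > 0 \<Longrightarrow> positive_laurent S (Poly_Mapping.single \<chi> c)"
  by (auto simp: positive_laurent_def laurent_polynomials_def lookup_single when_def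
      simp flip: keys_eq_empty)

lemma positive_laurent_one: "positive_laurent S 1"
  using positive_laurent_single[OF characters_zero, of 1 S] by simp

lemma positive_laurent_mult:
  assumes "positive_laurent S f" "positive_laurent S g"
  shows "positive_laurent S (f * g)"
proof -
  have f: "Poly_Mapping.keys f \<subseteq> characters S" "f \<noteq> 0" "\<forall>\<chi>. Poly_Mapping.lookup f \<chi> \<ge> 0"
    and g: "Poly_Mapping.keys g \<subseteq> characters S" "g \<noteq> 0" "\<forall>\<chi>. Poly_Mapping.lookup g \<chi> \<ge> 0"
    using assms by (simp_all add: positive_laurent_def laurent_polynomials_def)
  have "Poly_Mapping.keys (f * g) \<subseteq> characters S"
    unfolding keys_mult_nonneg[OF f(3) g(3)] using f(1) g(1) by (auto intro!: characters_add)
  then show ?thesis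
    using f g lookup_mult_nonneg[OF f(3) g(3)]
    by (simp add: positive_laurent_def laurent_polynomials_def)
qed

lemma keys_add_nonneg:
  fixes f g :: "'a \<Rightarrow>\<^sub>0 'k::linordered_field"
  assumes "\<forall>a. Poly_Mapping.lookup f a \<ge> 0" "\<forall>b. Poly_Mapping.lookup g b \<ge> 0"
  shows "Poly_Mapping.keys (f + g) = Poly_Mapping.keys f \<union> Poly_Mapping.keys g"
  using assms by (auto simp: in_keys_iff lookup_add add_nonneg_eq_0_iff)

lemma positive_laurent_add:
  assumes "positive_laurent S f" "positive_laurent S g"
  shows "positive_laurent S (f + g)"
  using assms keys_add_nonneg[of f g]
  by (auto simp: positive_laurent_def laurent_polynomials_def lookup_add simp flip: keys_eq_empty)

lemma trop_laurent_eq_Min_keys: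
  assumes "positive_laurent S f"
  shows "trop_laurent S f \<xi> = Min ((\<lambda>\<chi>. pairing S \<chi> \<xi>) ` Poly_Mapping.keys f)"
proof -
  have "{\<chi>. Poly_Mapping.lookup f \<chi> > 0} = Poly_Mapping.keys f"
    using assms by (auto simp: positive_laurent_def in_keys_iff order_less_le)
  then show ?thesis by (simp add: trop_laurent_def)
qed

lemma trop_laurent_single:
  "\<chi> \<in> characters S \<Longrightarrow> c > 0 \<Longrightarrow> trop_laurent S (Poly_Mapping.single \<chi> c) \<xi> = pairing S \<chi> \<xi>"
  by (simp add: trop_laurent_eq_Min_keys positive_laurent_single)

lemma trop_laurent_one: "trop_laurent S 1 \<xi> = 0"
  using trop_laurent_single[OF characters_zero, of 1 S] by simp

text \<open>
  The exponents of \<open>f * g\<close> are all the sums of an exponent of \<open>f\<close> and one of \<open>g\<close>, so the two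
  factors can be minimized independently.
\<close>

lemma trop_laurent_mult:
  assumes f: "positive_laurent S f" and g: "positive_laurent S g"
  shows "trop_laurent S (f * g) \<xi> = trop_laurent S f \<xi> + trop_laurent S g \<xi>"
proof -
  let ?p = "\<lambda>\<chi>. pairing S \<chi> \<xi>"
  let ?K = "Poly_Mapping.keys f" and ?L = "Poly_Mapping.keys g"
  have ne: "?K \<noteq> {}" "?L \<noteq> {}" using f g by (simp_all add: positive_laurent_def)
  obtain a where a: "a \<in> ?K" "Min (?p ` ?K) = ?p a"
    using Min_in[of "?p ` ?K"] ne by (metis finite_imageI finite_keys imageE image_is_empty)
  obtain b where b: "b \<in> ?L" "Min (?p ` ?L) = ?p b"
    using Min_in[of "?p ` ?L"] ne by (metis finite_imageI finite_keys imageE image_is_empty)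
  have keys: "Poly_Mapping.keys (f * g) = (\<lambda>(a, b). a + b) ` (?K \<times> ?L)"
    using f g by (intro keys_mult_nonneg) (auto simp: positive_laurent_def)
  have "Min (?p ` Poly_Mapping.keys (f * g)) = ?p a + ?p b"
  proof (rule Min_eqI)
    have "a + b \<in> Poly_Mapping.keys (f * g)" using a b unfolding keys by force
    then show "?p a + ?p b \<in> ?p ` Poly_Mapping.keys (f * g)"
      by (metis pairing_add image_eqI)
    fix y assume "y \<in> ?p ` Poly_Mapping.keys (f * g)"
    then obtain a' b' where "a' \<in> ?K" "b' \<in> ?L" "y = ?p a' + ?p b'"
      unfolding keys by (auto simp: pairing_add)
    then show "?p a + ?p b \<le> y"
      using Min_le[of "?p ` ?K" "?p a'"] Min_le[of "?p ` ?L" "?p b'"] a b by auto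
  qed simp
  then show ?thesis
    using f g a b by (simp add: trop_laurent_eq_Min_keys positive_laurent_mult)
qed

lemma trop_laurent_add:
  assumes f: "positive_laurent S f" and g: "positive_laurent S g"
  shows "trop_laurent S (f + g) \<xi> = min (trop_laurent S f \<xi>) (trop_laurent S g \<xi>)"
proof -
  have "Poly_Mapping.keys (f + g) = Poly_Mapping.keys f \<union> Poly_Mapping.keys g"
    using f g by (intro keys_add_nonneg) (auto simp: positive_laurent_def)
  moreover have "Poly_Mapping.keys f \<noteq> {}" "Poly_Mapping.keys g \<noteq> {}"
    using f g by (simp_all add: positive_laurent_def)
  ultimately show ?thesis
    using f g by (simp add: trop_laurent_eq_Min_keys positive_laurent_add image_Un Min_Un)
qed


section \<open>Positive rational functions\<close>

text \<open>
  This is the relation of which \<open>trop_function S F \<xi>\<close> is the unique value.  As a relation it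
  also carries the information that \<open>F\<close> is a quotient of positive Laurent polynomials, so that
  its closure properties can be proved and chained without side conditions.
\<close>

definition trop_value ::
    "'i set \<Rightarrow> ('i \<Rightarrow> int) \<Rightarrow> ('i, 'k::linordered_field) rational_function \<Rightarrow> int \<Rightarrow> bool"
  where "trop_value S \<xi> F v \<longleftrightarrow> (\<exists>f g. positive_laurent S f \<and> positive_laurent S g \<and>
    F = to_fract f / to_fract g \<and> v = trop_laurent S f \<xi> - trop_laurent S g \<xi>)"

lemma trop_valueE:
  assumes "trop_value S \<xi> F v"
  obtains f g where "positive_laurent S f" "positive_laurent S g" "f \<noteq> 0" "g \<noteq> 0"
    "F = to_fract f / to_fract g" "v = trop_laurent S f \<xi> - trop_laurent S g \<xi>"
  using assms unfolding trop_value_def positive_laurent_def by blast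

lemma trop_value_nonzero: "trop_value S \<xi> F v \<Longrightarrow> F \<noteq> 0"
  by (erule trop_valueE) simp

text \<open>
  Two representations \<open>f / g = f' / g'\<close> satisfy \<open>f * g' = f' * g\<close>, an identity of positive Laurent
  polynomials, to which additivity of tropicalization applies.
\<close>

lemma trop_value_unique:
  assumes "trop_value S \<xi> F v" "trop_value S \<xi> F w"
  shows "v = w"
proof -
  obtain f g where f: "positive_laurent S f" "positive_laurent S g" "f \<noteq> 0" "g \<noteq> 0"
    "F = to_fract f / to_fract g" "v = trop_laurent S f \<xi> - trop_laurent S g \<xi>"
    using assms(1) by (rule trop_valueE)
  obtain f' g' where f': "positive_laurent S f'" "positive_laurent S g'" "f' \<noteq> 0" "g' \<noteq> 0"
    "F = to_fract f' / to_fract g'" "w = trop_laurent S f' \<xi> - trop_laurent S g' \<xi>"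
    using assms(2) by (rule trop_valueE)
  have "to_fract (f * g') = to_fract (f' * g)"
    using f f' by (simp add: field_simps)
  then have "f * g' = f' * g" by (simp only: to_fract_eq_iff)
  then have "trop_laurent S f \<xi> + trop_laurent S g' \<xi> = trop_laurent S f' \<xi> + trop_laurent S g \<xi>"
    using f f' by (metis trop_laurent_mult)
  then show ?thesis using f f' by simp
qed

lemma trop_function_eq: "trop_value S \<xi> F v \<Longrightarrow> trop_function S F \<xi> = v"
  unfolding trop_function_def trop_value_def[symmetric]
  by (rule the_equality) (auto intro: trop_value_unique)

lemma trop_value_laurent:
  "positive_laurent S f \<Longrightarrow> trop_value S \<xi> (to_fract f) (trop_laurent S f \<xi>)"
  unfolding trop_value_def
  by (rule exI[of _ f], rule exI[of _ 1]) (simp add: positive_laurent_one trop_laurent_one)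

lemma trop_value_const: "c > 0 \<Longrightarrow> trop_value S \<xi> (to_fract (Poly_Mapping.single 0 c)) 0"
  using trop_value_laurent[OF positive_laurent_single[OF characters_zero], of c S \<xi>]
  by (simp add: trop_laurent_single characters_zero)

lemma trop_value_one: "trop_value S \<xi> 1 0"
  using trop_value_laurent[OF positive_laurent_one, of S \<xi>] by (simp add: trop_laurent_one)

lemma trop_value_coordinate:
  "finite S \<Longrightarrow> i \<in> S \<Longrightarrow> trop_value S \<xi> (coordinate i) (\<xi> i)"
  using trop_value_laurent[OF positive_laurent_single[OF coordinate_character_in_characters], of i S 1 \<xi>]
  by (simp add: coordinate_def trop_laurent_single coordinate_character_in_characters
      pairing_coordinate_character)

lemma trop_value_mult:
  assumes "trop_value S \<xi> F v" "trop_value S \<xi> G w"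
  shows "trop_value S \<xi> (F * G) (v + w)"
proof -
  obtain f g where f: "positive_laurent S f" "positive_laurent S g" "f \<noteq> 0" "g \<noteq> 0"
    "F = to_fract f / to_fract g" "v = trop_laurent S f \<xi> - trop_laurent S g \<xi>"
    using assms(1) by (rule trop_valueE)
  obtain f' g' where f': "positive_laurent S f'" "positive_laurent S g'" "f' \<noteq> 0" "g' \<noteq> 0"
    "G = to_fract f' / to_fract g'" "w = trop_laurent S f' \<xi> - trop_laurent S g' \<xi>"
    using assms(2) by (rule trop_valueE)
  show ?thesis
    unfolding trop_value_def
    by (rule exI[of _ "f * f'"], rule exI[of _ "g * g'"])
      (use f f' in \<open>simp add: positive_laurent_mult trop_laurent_mult\<close>)
qed

lemma trop_value_inverse:
  assumes "trop_value S \<xi> F v"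
  shows "trop_value S \<xi> (inverse F) (- v)"
proof -
  obtain f g where f: "positive_laurent S f" "positive_laurent S g" "f \<noteq> 0" "g \<noteq> 0"
    "F = to_fract f / to_fract g" "v = trop_laurent S f \<xi> - trop_laurent S g \<xi>"
    using assms(1) by (rule trop_valueE)
  show ?thesis
    unfolding trop_value_def
    by (rule exI[of _ g], rule exI[of _ f]) (use f in simp)
qed

lemma trop_value_add:
  assumes "trop_value S \<xi> F v" "trop_value S \<xi> G w"
  shows "trop_value S \<xi> (F + G) (min v w)"
proof -
  obtain f g where f: "positive_laurent S f" "positive_laurent S g" "f \<noteq> 0" "g \<noteq> 0"
    "F = to_fract f / to_fract g" "v = trop_laurent S f \<xi> - trop_laurent S g \<xi>"
    using assms(1) by (rule trop_valueE)
  obtain f' g' where f': "positive_laurent S f'" "positive_laurent S g'" "f' \<noteq> 0" "g' \<noteq> 0"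
    "G = to_fract f' / to_fract g'" "w = trop_laurent S f' \<xi> - trop_laurent S g' \<xi>"
    using assms(2) by (rule trop_valueE)
  have "F + G = to_fract (f * g' + f' * g) / to_fract (g * g')"
    using f f' by (simp add: add_frac_eq)
  moreover have "min v w = trop_laurent S (f * g' + f' * g) \<xi> - trop_laurent S (g * g') \<xi>"
    using f f' by (simp add: positive_laurent_mult trop_laurent_mult trop_laurent_add min_def)
  ultimately show ?thesis
    unfolding trop_value_def using f f'
    by (intro exI[of _ "f * g' + f' * g"] exI[of _ "g * g'"])
      (simp add: positive_laurent_mult positive_laurent_add)
qed

lemma trop_value_power:
  "trop_value S \<xi> F v \<Longrightarrow> trop_value S \<xi> (F ^ n) (int n * v)"
  by (induction n) (auto simp: trop_value_one distrib_right intro: trop_value_mult)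

lemma trop_value_powi:
  assumes "trop_value S \<xi> F v"
  shows "trop_value S \<xi> (F powi n) (n * v)"
proof (cases "n \<ge> 0")
  case True
  then show ?thesis
    using trop_value_power[OF assms, of "nat n"] by (simp add: power_int_def)
next
  case False
  then show ?thesis
    using trop_value_power[OF trop_value_inverse[OF assms], of "nat (- n)"]
    by (simp add: power_int_def)
qed

lemma trop_value_prod:
  assumes "\<And>a. a \<in> A \<Longrightarrow> trop_value S \<xi> (F a) (v a)"
  shows "trop_value S \<xi> (prod F A) (sum v A)"
  using assms
  by (induction A rule: infinite_finite_induct) (auto simp: trop_value_one intro: trop_value_mult)

lemma trop_value_sum:
  assumes "finite A" "A \<noteq> {}" "\<And>a. a \<in> A \<Longrightarrow> trop_value S \<xi> (F a) (v a)"
  shows "trop_value S \<xi> (sum F A) (Min (v ` A))"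
  using assms
  by (induction A rule: finite_ne_induct) (auto intro: trop_value_add)


section \<open>Positive maps and their composites\<close>

lemma trop_value_character_pullback:
  assumes "\<And>i. i \<in> S' \<Longrightarrow> trop_value S \<xi> (\<phi> i) (\<eta> i)"
  shows "trop_value S \<xi> (character_pullback S' \<phi> \<chi>) (pairing S' \<chi> \<eta>)"
  unfolding character_pullback_def pairing_def
  by (intro trop_value_prod trop_value_powi assms)

text \<open>
  A positive map is tropicalized coordinate by coordinate: the coordinate characters determine
  \<open>\<eta>\<close>, and compatibility with all other characters is automatic, since those pull back to
  monomials in the components of \<open>\<phi>\<close>.
\<close>

lemma tropicalization_eq:
  assumes fin: "finite S'" and \<eta>: "\<eta> \<in> cocharacters S'"
    and val: "\<And>i. i \<in> S' \<Longrightarrow> trop_value S \<xi> (\<phi> i) (\<eta> i)"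
  shows "tropicalization S S' \<phi> \<xi> = \<eta>"
proof -
  have trop: "trop_function S (character_pullback S' \<phi> \<chi>) \<xi> = pairing S' \<chi> \<eta>" for \<chi>
    using val by (intro trop_function_eq trop_value_character_pullback)
  show ?thesis
    unfolding tropicalization_def trop
  proof (rule the_equality)
    fix \<eta>'
    assume \<eta>': "\<eta>' \<in> cocharacters S' \<and> (\<forall>\<chi>\<in>characters S'. pairing S' \<chi> \<eta>' = pairing S' \<chi> \<eta>)"
    show "\<eta>' = \<eta>"
    proof
      fix i
      show "\<eta>' i = \<eta> i"
      proof (cases "i \<in> S'")
        case True
        then show ?thesis
          using \<eta>' coordinate_character_in_characters[OF True]
          by (metis fin pairing_coordinate_character)
      next
        case False
        then have "\<eta> i = 0" "\<eta>' i = 0" using \<eta> \<eta>' unfolding cocharacters_def by blast+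
        then show ?thesis by simp
      qed
    qed
  qed (simp add: \<eta>)
qed

lemma character_pullback_add:
  assumes "\<And>i. i \<in> S' \<Longrightarrow> \<phi> i \<noteq> 0"
  shows "character_pullback S' \<phi> (\<chi> + \<chi>') = character_pullback S' \<phi> \<chi> * character_pullback S' \<phi> \<chi>'"
  using assms
  by (simp add: character_pullback_def plus_character.rep_eq power_int_add flip: prod.distrib)

lemma laurent_pullback_superset:
  assumes "finite A" "Poly_Mapping.keys f \<subseteq> A"
  shows "laurent_pullback S' \<phi> f =
    (\<Sum>\<chi>\<in>A. to_fract (Poly_Mapping.single 0 (Poly_Mapping.lookup f \<chi>)) * character_pullback S' \<phi> \<chi>)"
  unfolding laurent_pullback_def using assms
  by (intro sum.mono_neutral_left) (auto simp: in_keys_iff)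

lemma laurent_pullback_zero [simp]: "laurent_pullback S' \<phi> 0 = 0"
  by (simp add: laurent_pullback_def)

lemma laurent_pullback_add:
  "laurent_pullback S' \<phi> (f + g) = laurent_pullback S' \<phi> f + laurent_pullback S' \<phi> g"
proof -
  let ?A = "Poly_Mapping.keys f \<union> Poly_Mapping.keys g"
  have "Poly_Mapping.keys (f + g) \<subseteq> ?A" by (rule keys_add)
  then show ?thesis
    by (simp add: laurent_pullback_superset[of ?A] lookup_add single_add distrib_right sum.distrib)
qed

lemma laurent_pullback_sum:
  "laurent_pullback S' \<phi> (sum f A) = (\<Sum>a\<in>A. laurent_pullback S' \<phi> (f a))"
  by (induction A rule: infinite_finite_induct) (simp_all add: laurent_pullback_add)

lemma laurent_pullback_single:
  "laurent_pullback S' \<phi> (Poly_Mapping.single \<chi> c) =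
    to_fract (Poly_Mapping.single 0 c) * character_pullback S' \<phi> \<chi>"
  by (simp add: laurent_pullback_superset[of "{\<chi>}"])

lemma laurent_pullback_mult:
  fixes f g :: "('i, 'k::idom) laurent"
  assumes "\<And>i. i \<in> S' \<Longrightarrow> \<phi> i \<noteq> 0"
  shows "laurent_pullback S' \<phi> (f * g) = laurent_pullback S' \<phi> f * laurent_pullback S' \<phi> g"
proof -
  have const: "to_fract (Poly_Mapping.single 0 (a * b)) =
      to_fract (Poly_Mapping.single 0 a) * to_fract (Poly_Mapping.single 0 b)"
    for a b :: 'k
    by (simp add: mult_single flip: to_fract_mult)
  have "laurent_pullback S' \<phi> (f * g) =
      (\<Sum>a\<in>Poly_Mapping.keys f. \<Sum>b\<in>Poly_Mapping.keys g.
        (to_fract (Poly_Mapping.single 0 (Poly_Mapping.lookup f a)) * character_pullback S' \<phi> a) *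
        (to_fract (Poly_Mapping.single 0 (Poly_Mapping.lookup g b)) * character_pullback S' \<phi> b))"
    unfolding poly_mapping_mult_eq_sum_single[of f g] laurent_pullback_sum laurent_pullback_single
    by (simp only: const character_pullback_add[OF assms] mult_ac)
  then show ?thesis by (simp only: laurent_pullback_def sum_product)
qed

text \<open>
  Substituting \<open>\<phi>\<close> turns each monomial \<open>\<chi>\<close> of \<open>f\<close> into a positive function of value
  \<open>pairing S' \<chi> \<eta>\<close>; positive coefficients do not affect values, and a sum takes the minimum.
\<close>

lemma trop_value_laurent_pullback:
  assumes f: "positive_laurent S' f" and \<phi>: "\<And>i. i \<in> S' \<Longrightarrow> trop_value S \<xi> (\<phi> i) (\<eta> i)"
  shows "trop_value S \<xi> (laurent_pullback S' \<phi> f) (trop_laurent S' f \<eta>)"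
  unfolding laurent_pullback_def trop_laurent_eq_Min_keys[OF f]
proof (rule trop_value_sum)
  show "Poly_Mapping.keys f \<noteq> {}" using f by (simp add: positive_laurent_def)
  fix \<chi> assume "\<chi> \<in> Poly_Mapping.keys f"
  then have "Poly_Mapping.lookup f \<chi> > 0"
    using f by (simp add: positive_laurent_def in_keys_iff order_less_le)
  from trop_value_mult[OF trop_value_const[OF this] trop_value_character_pullback[of S' S \<xi> \<phi> \<eta> \<chi>]]
  show "trop_value S \<xi> (to_fract (Poly_Mapping.single 0 (Poly_Mapping.lookup f \<chi>)) *
      character_pullback S' \<phi> \<chi>) (pairing S' \<chi> \<eta>)"
    using \<phi> by simp
qed simp

text \<open>
  The value of the description operator: cross-multiplying two fractions for the same function
  and substituting \<open>\<phi>\<close> shows that they pull back to the same function.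
\<close>

lemma pullback_fraction:
  assumes \<phi>: "\<And>i. i \<in> S' \<Longrightarrow> \<phi> i \<noteq> 0"
    and f: "f \<in> laurent_polynomials S'" and g: "g \<in> laurent_polynomials S'"
    and nz: "laurent_pullback S' \<phi> g \<noteq> 0"
  shows "pullback S' \<phi> (to_fract f / to_fract g) = laurent_pullback S' \<phi> f / laurent_pullback S' \<phi> g"
  unfolding pullback_def
proof (rule the_equality)
  fix G
  assume "\<exists>f'\<in>laurent_polynomials S'. \<exists>g'\<in>laurent_polynomials S'.
    to_fract f / to_fract g = to_fract f' / to_fract g' \<and> laurent_pullback S' \<phi> g' \<noteq> 0 \<and>
    G = laurent_pullback S' \<phi> f' / laurent_pullback S' \<phi> g'"
  then obtain f' g' where eq: "to_fract f / to_fract g = to_fract f' / to_fract g'"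
    and nz': "laurent_pullback S' \<phi> g' \<noteq> 0"
    and G: "G = laurent_pullback S' \<phi> f' / laurent_pullback S' \<phi> g'" by blast
  have "g \<noteq> 0" "g' \<noteq> 0" using nz nz' by auto
  then have "to_fract (f * g') = to_fract (f' * g)"
    using eq by (simp add: field_simps)
  then have "f * g' = f' * g" by (simp only: to_fract_eq_iff)
  then have "laurent_pullback S' \<phi> (f * g') = laurent_pullback S' \<phi> (f' * g)" by simp
  then have "laurent_pullback S' \<phi> f * laurent_pullback S' \<phi> g' =
      laurent_pullback S' \<phi> f' * laurent_pullback S' \<phi> g"
    by (simp only: laurent_pullback_mult[OF \<phi>])
  then show "G = laurent_pullback S' \<phi> f / laurent_pullback S' \<phi> g"
    using nz nz' by (simp add: G field_simps)
qed (use f g nz in blast)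

text \<open>
  Functoriality: tropicalizing \<open>F \<circ> \<phi>\<close> at \<open>\<xi>\<close> amounts to tropicalizing \<open>F\<close> at \<open>\<eta> = \<phi>\<^sup>t(\<xi>)\<close>.
  Positivity also guarantees that the denominator of \<open>F\<close> does not vanish after substitution.
\<close>

lemma trop_value_pullback:
  assumes F: "trop_value S' \<eta> F v" and \<phi>: "\<And>i. i \<in> S' \<Longrightarrow> trop_value S \<xi> (\<phi> i) (\<eta> i)"
  shows "trop_value S \<xi> (pullback S' \<phi> F) v"
proof -
  obtain f g where f: "positive_laurent S' f" and g: "positive_laurent S' g"
    and F: "F = to_fract f / to_fract g" and v: "v = trop_laurent S' f \<eta> - trop_laurent S' g \<eta>"
    using F by (rule trop_valueE)
  have vals: "trop_value S \<xi> (laurent_pullback S' \<phi> f) (trop_laurent S' f \<eta>)"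
    "trop_value S \<xi> (laurent_pullback S' \<phi> g) (trop_laurent S' g \<eta>)"
    using f g \<phi> by (auto intro: trop_value_laurent_pullback)
  have "pullback S' \<phi> F = laurent_pullback S' \<phi> f / laurent_pullback S' \<phi> g"
    unfolding F using f g \<phi> trop_value_nonzero vals(2)
    by (intro pullback_fraction) (auto simp: positive_laurent_def dest: trop_value_nonzero)
  moreover have "trop_value S \<xi> (laurent_pullback S' \<phi> f * inverse (laurent_pullback S' \<phi> g)) v"
    using trop_value_mult[OF vals(1) trop_value_inverse[OF vals(2)]] by (simp add: v)
  ultimately show ?thesis by (simp add: divide_inverse)
qed


section \<open>Tropical mutations and Langlands duality\<close>

definition trop_mutation :: "'i \<Rightarrow> 'i seed \<Rightarrow> ('i \<Rightarrow> int) \<Rightarrow> ('i \<Rightarrow> int)"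
  where "trop_mutation k \<sigma> \<xi> = \<xi>(k := - \<xi> k + min
    (\<Sum>j | j \<in> indices \<sigma> \<and> exchange_matrix \<sigma> j k > 0. exchange_matrix \<sigma> j k * \<xi> j)
    (\<Sum>j | j \<in> indices \<sigma> \<and> exchange_matrix \<sigma> j k < 0. - exchange_matrix \<sigma> j k * \<xi> j))"

primrec trop_mutation_seq :: "'i list \<Rightarrow> 'i seed \<Rightarrow> ('i \<Rightarrow> int) \<Rightarrow> ('i \<Rightarrow> int)"
  where
    "trop_mutation_seq [] \<sigma> \<xi> = \<xi>"
  | "trop_mutation_seq (k # ks) \<sigma> \<xi> = trop_mutation_seq ks (mutate k \<sigma>) (trop_mutation k \<sigma> \<xi>)"

lemma indices_mutate [simp]: "indices (mutate k \<sigma>) = indices \<sigma>"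
  by (simp add: mutate_def)

lemma indices_mutate_seq [simp]: "indices (mutate_seq ks \<sigma>) = indices \<sigma>"
  by (induction ks arbitrary: \<sigma>) simp_all

lemma indices_dual [simp]: "indices (dual \<sigma>) = indices \<sigma>"
  by (simp add: dual_def)

lemma trop_value_mutation:
  assumes "finite (indices \<sigma>)" "i \<in> indices \<sigma>"
  shows "trop_value (indices \<sigma>) \<xi> (mutation k \<sigma> i) (trop_mutation k \<sigma> \<xi> i)"
proof (cases "i = k")
  case True
  have coord: "trop_value (indices \<sigma>) \<xi> (coordinate j) (\<xi> j)" if "j \<in> indices \<sigma>" for j
    using assms(1) that by (rule trop_value_coordinate)
  have "trop_value (indices \<sigma>) \<xi> (mutation k \<sigma> k) (trop_mutation k \<sigma> \<xi> k)"
    unfolding mutation_def trop_mutation_def fun_upd_same if_P[OF refl]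
    by (intro trop_value_mult trop_value_inverse trop_value_add trop_value_prod trop_value_powi coord)
      (use assms(2) True in auto)
  with True show ?thesis by simp
next
  case False
  then show ?thesis
    using assms by (simp add: mutation_def trop_mutation_def trop_value_coordinate)
qed

lemma trop_value_mutation_seq:
  assumes "finite (indices \<sigma>)" "i \<in> indices \<sigma>"
  shows "trop_value (indices \<sigma>) \<xi> (mutation_seq ks \<sigma> i :: ('i, 'k::linordered_field) rational_function)
    (trop_mutation_seq ks \<sigma> \<xi> i)"
  using assms
proof (induction ks arbitrary: \<sigma> \<xi>)
  case Nil
  then show ?case by (simp add: trop_value_coordinate)
next
  case (Cons k ks)
  have "trop_value (indices \<sigma>) (trop_mutation k \<sigma> \<xi>)
      (mutation_seq ks (mutate k \<sigma>) i :: ('i, 'k) rational_function)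
      (trop_mutation_seq ks (mutate k \<sigma>) (trop_mutation k \<sigma> \<xi>) i)"
    using Cons.IH[of "mutate k \<sigma>"] Cons.prems by simp
  from trop_value_pullback[OF this trop_value_mutation[OF Cons.prems(1)]]
  show ?case by (simp add: compose_def)
qed

lemma trop_mutation_seq_cocharacters:
  "set ks \<subseteq> indices \<sigma> \<Longrightarrow> \<xi> \<in> cocharacters (indices \<sigma>) \<Longrightarrow>
    trop_mutation_seq ks \<sigma> \<xi> \<in> cocharacters (indices \<sigma>)"
proof (induction ks arbitrary: \<sigma> \<xi>)
  case (Cons k ks)
  have "trop_mutation k \<sigma> \<xi> \<in> cocharacters (indices \<sigma>)"
    using Cons.prems by (auto simp: trop_mutation_def cocharacters_def)
  then show ?case using Cons.IH[of "mutate k \<sigma>"] Cons.prems by simp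
qed simp

lemma tropicalization_mutation_seq:
  assumes "finite (indices \<sigma>)" "set ks \<subseteq> indices \<sigma>" "\<xi> \<in> cocharacters (indices \<sigma>)"
  shows "tropicalization (indices \<sigma>) (indices \<sigma>)
    (mutation_seq ks \<sigma> :: ('i, 'k::linordered_field) rational_map) \<xi> = trop_mutation_seq ks \<sigma> \<xi>"
proof (rule tropicalization_eq)
  show "trop_mutation_seq ks \<sigma> \<xi> \<in> cocharacters (indices \<sigma>)"
    using assms(2,3) by (rule trop_mutation_seq_cocharacters)
qed (use assms(1) in \<open>simp_all add: trop_value_mutation_seq\<close>)

lemma tropicalization_power_map:
  assumes "finite S" "\<xi> \<in> cocharacters S"
  shows "tropicalization S S (power_map d :: ('i, 'k::linordered_field) rational_map) \<xi> =
    (\<lambda>i. d i * \<xi> i)"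
proof (rule tropicalization_eq)
  show "(\<lambda>i. d i * \<xi> i) \<in> cocharacters S"
    using assms(2) by (simp add: cocharacters_def)
  show "trop_value S \<xi> (power_map d i :: ('i, 'k) rational_function) (d i * \<xi> i)" if "i \<in> S" for i
    unfolding power_map_def using assms(1) that by (intro trop_value_powi trop_value_coordinate)
qed (rule assms(1))

text \<open>
  Multiplying the correction term \<open>s\<^sub>i\<^sub>j = \<bar>M\<^sub>i\<^sub>k\<bar> M\<^sub>k\<^sub>j + M\<^sub>i\<^sub>k \<bar>M\<^sub>k\<^sub>j\<bar>\<close> by \<open>d\<^sub>j\<close> and moving the index \<open>k\<close> to
  the right in \<open>M\<^sub>k\<^sub>j d\<^sub>j = - M\<^sub>j\<^sub>k d\<^sub>k\<close> gives
  \<open>d\<^sub>k (M\<^sub>i\<^sub>k \<bar>M\<^sub>j\<^sub>k\<bar> - \<bar>M\<^sub>i\<^sub>k\<bar> M\<^sub>j\<^sub>k)\<close>, which is visibly antisymmetric in \<open>i\<close> and \<open>j\<close>.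
\<close>

lemma skew_symmetrizer_mutate:
  assumes d: "skew_symmetrizer \<sigma> d" and k: "k \<in> indices \<sigma>"
  shows "skew_symmetrizer (mutate k \<sigma>) d"
proof -
  let ?M = "exchange_matrix \<sigma>" and ?N = "exchange_matrix (mutate k \<sigma>)"
  have skew: "?M i j * d j = - (?M j i * d i)" if "i \<in> indices \<sigma>" "j \<in> indices \<sigma>" for i j
    using d that unfolding skew_symmetrizer_def by blast
  have pos: "d i > 0" if "i \<in> indices \<sigma>" for i
    using d that unfolding skew_symmetrizer_def by blast
  have "?N i j * d j = - (?N j i * d i)" if i: "i \<in> indices \<sigma>" and j: "j \<in> indices \<sigma>" for i j
  proof (cases "k = i \<or> k = j")
    case True
    then have "?N i j = - ?M i j" "?N j i = - ?M j i"
      by (auto simp: mutate_def matrix_mutation_def)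
    then show ?thesis using skew[OF i j] by simp
  next
    case False
    define s where "s i j = \<bar>?M i k\<bar> * ?M k j + ?M i k * \<bar>?M k j\<bar>" for i j
    have abs_skew: "\<bar>?M k l\<bar> * d l = \<bar>?M l k\<bar> * d k" if "l \<in> indices \<sigma>" for l
      using arg_cong[OF skew[OF k that], of abs] pos[OF k] pos[OF that] by (simp add: abs_mult)
    have s: "s i j * d j = d k * (?M i k * \<bar>?M j k\<bar> - \<bar>?M i k\<bar> * ?M j k)"
      if "i \<in> indices \<sigma>" "j \<in> indices \<sigma>" for i j
    proof -
      have "s i j * d j = \<bar>?M i k\<bar> * (?M k j * d j) + ?M i k * (\<bar>?M k j\<bar> * d j)"
        by (simp add: s_def algebra_simps)
      also have "\<dots> = d k * (?M i k * \<bar>?M j k\<bar> - \<bar>?M i k\<bar> * ?M j k)"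
        by (simp only: skew[OF k that(2)] abs_skew[OF that(2)]) (simp add: algebra_simps)
      finally show ?thesis .
    qed
    have half: "2 * (s a b div 2) = s a b" for a b
      using even_mutation_term[of "?M a k" "?M k b"] by (simp add: s_def)
    \<comment> \<open>Everything is doubled so that the exact division by 2 disappears.\<close>
    have "2 * (?N i j * d j) = 2 * (?M i j * d j) + 2 * (s i j div 2) * d j"
      using False by (simp add: mutate_def matrix_mutation_def s_def algebra_simps)
    also have "\<dots> = 2 * (?M i j * d j) + s i j * d j" by (simp only: half)
    also have "\<dots> = - (2 * (?M j i * d i) + s j i * d i)"
      by (simp only: s[OF i j] s[OF j i] skew[OF i j]) (simp add: algebra_simps)
    also have "\<dots> = - (2 * (?M j i * d i) + 2 * (s j i div 2) * d i)" by (simp only: half)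
    also have "\<dots> = 2 * - (?N j i * d i)"
      using False by (simp add: mutate_def matrix_mutation_def s_def algebra_simps)
    finally show ?thesis by linarith
  qed
  then show ?thesis using pos unfolding skew_symmetrizer_def indices_mutate by blast
qed

text \<open>
  The relation \<open>entry\<close> below both matches the signs of the two
  exchange matrices, so that the same indices enter each monomial, and extracts the common
  factor \<open>d k\<close> from the minimum; the latter needs \<open>d k > 0\<close>.
\<close>

lemma trop_mutation_dual:
  assumes d: "skew_symmetrizer \<sigma> d" and k: "k \<in> indices \<sigma>"
  shows "trop_mutation k (dual \<sigma>) (\<lambda>i. d i * \<xi> i) = (\<lambda>i. d i * trop_mutation k \<sigma> \<xi> i)"
proof -
  let ?M = "exchange_matrix \<sigma>" and ?N = "exchange_matrix (dual \<sigma>)"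
  have dk: "d k > 0" using d k unfolding skew_symmetrizer_def by blast
  have entry: "?N j k * d j = d k * ?M j k" if "j \<in> indices \<sigma>" for j
  proof -
    have "?M j k * d k = - (?M k j * d j)" using d k that unfolding skew_symmetrizer_def by blast
    then show ?thesis by (simp add: dual_def mult.commute)
  qed
  have sign: "?N j k > 0 \<longleftrightarrow> ?M j k > 0" "?N j k < 0 \<longleftrightarrow> ?M j k < 0" if "j \<in> indices \<sigma>" for j
  proof -
    have "d j > 0" using d that unfolding skew_symmetrizer_def by blast
    then have "?N j k > 0 \<longleftrightarrow> ?N j k * d j > 0" "?N j k < 0 \<longleftrightarrow> ?N j k * d j < 0"
      by (simp_all add: zero_less_mult_iff mult_less_0_iff)
    moreover have "?M j k > 0 \<longleftrightarrow> d k * ?M j k > 0" "?M j k < 0 \<longleftrightarrow> d k * ?M j k < 0"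
      using dk by (simp_all add: zero_less_mult_iff mult_less_0_iff)
    ultimately show "?N j k > 0 \<longleftrightarrow> ?M j k > 0" "?N j k < 0 \<longleftrightarrow> ?M j k < 0"
      by (simp_all only: entry[OF that])
  qed
  have sets: "{j \<in> indices \<sigma>. ?N j k > 0} = {j \<in> indices \<sigma>. ?M j k > 0}"
    "{j \<in> indices \<sigma>. ?N j k < 0} = {j \<in> indices \<sigma>. ?M j k < 0}"
    using sign by auto
  have sum: "(\<Sum>j\<in>A. ?N j k * (d j * \<xi> j)) = d k * (\<Sum>j\<in>A. ?M j k * \<xi> j)"
    if "A \<subseteq> indices \<sigma>" for A
  proof -
    have "?N j k * (d j * \<xi> j) = d k * (?M j k * \<xi> j)" if "j \<in> A" for j
      using entry[of j] that \<open>A \<subseteq> indices \<sigma>\<close> by (simp add: subset_iff flip: mult.assoc)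
    then show ?thesis unfolding sum_distrib_left by (rule sum.cong[OF refl])
  qed
  have "trop_mutation k (dual \<sigma>) (\<lambda>i. d i * \<xi> i) k = - (d k * \<xi> k) +
      min (d k * (\<Sum>j | j \<in> indices \<sigma> \<and> ?M j k > 0. ?M j k * \<xi> j))
        (d k * (\<Sum>j | j \<in> indices \<sigma> \<and> ?M j k < 0. - ?M j k * \<xi> j))"
    by (simp add: trop_mutation_def sets sum_negf sum)
  also have "\<dots> = d k * trop_mutation k \<sigma> \<xi> k"
  proof -
    have "min (d k * x) (d k * y) = d k * min x y" for x y
      using dk by (simp add: min_def mult_le_cancel_left_pos)
    then show ?thesis by (simp add: trop_mutation_def right_diff_distrib)
  qed
  finally show ?thesis by (auto simp: trop_mutation_def)
qed

lemma trop_mutation_seq_dual: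
  assumes "skew_symmetrizer \<sigma> d" "set ks \<subseteq> indices \<sigma>"
  shows "trop_mutation_seq ks (dual \<sigma>) (\<lambda>i. d i * \<xi> i) = (\<lambda>i. d i * trop_mutation_seq ks \<sigma> \<xi> i)"
  using assms
proof (induction ks arbitrary: \<sigma> \<xi>)
  case (Cons k ks)
  then show ?case
    using Cons.IH[OF skew_symmetrizer_mutate] by (simp add: trop_mutation_dual mutate_dual)
qed simp

theorem proposition4p7:
  fixes \<sigma> :: "'i seed" and d :: "'i \<Rightarrow> int" and ks :: "'i list"
    and \<mu> \<mu>_dual \<Psi> \<Psi>_mut :: "('i, 'k::linordered_field) rational_map"
    and \<psi> \<psi>_mut :: "('i \<Rightarrow> int) \<Rightarrow> ('i \<Rightarrow> int)"
  assumes "is_seed \<sigma>"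
    and "skew_symmetrizer \<sigma> d"
    and "set ks \<subseteq> directions \<sigma>"
    and "\<mu> = mutation_seq ks \<sigma>"
    and "\<mu>_dual = mutation_seq ks (dual \<sigma>)"
    and "\<Psi> = power_map d"
    and "\<Psi>_mut = power_map d"
    and "\<psi> = tropicalization (indices \<sigma>) (indices (dual \<sigma>)) \<Psi>"
    and "\<psi>_mut = tropicalization (indices (mutate_seq ks \<sigma>)) (indices (dual (mutate_seq ks \<sigma>))) \<Psi>_mut"
  shows "\<forall>\<xi>\<in>cocharacters (indices \<sigma>).
    tropicalization (indices (dual \<sigma>)) (indices (mutate_seq ks (dual \<sigma>))) \<mu>_dual (\<psi> \<xi>) =
    \<psi>_mut (tropicalization (indices \<sigma>) (indices (mutate_seq ks \<sigma>)) \<mu> \<xi>)"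
proof
  fix \<xi> assume \<xi>: "\<xi> \<in> cocharacters (indices \<sigma>)"
  have fin: "finite (indices \<sigma>)" and ks: "set ks \<subseteq> indices \<sigma>"
    using assms(1,3) by (auto simp: is_seed_def)
  have d\<xi>: "(\<lambda>i. d i * \<xi> i) \<in> cocharacters (indices \<sigma>)"
    using \<xi> by (simp add: cocharacters_def)
  have "tropicalization (indices (dual \<sigma>)) (indices (mutate_seq ks (dual \<sigma>))) \<mu>_dual (\<psi> \<xi>) =
      trop_mutation_seq ks (dual \<sigma>) (\<lambda>i. d i * \<xi> i)"
    using tropicalization_mutation_seq[of "dual \<sigma>" ks "\<lambda>i. d i * \<xi> i", where 'k = 'k]
    by (simp add: assms(5,6,8) tropicalization_power_map fin ks \<xi> d\<xi>)
  also have "\<dots> = (\<lambda>i. d i * trop_mutation_seq ks \<sigma> \<xi> i)"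
    by (rule trop_mutation_seq_dual[OF assms(2) ks])
  also have "\<dots> = \<psi>_mut (tropicalization (indices \<sigma>) (indices (mutate_seq ks \<sigma>)) \<mu> \<xi>)"
    using trop_mutation_seq_cocharacters[OF ks \<xi>]
    by (simp add: assms(4,7,9) tropicalization_mutation_seq tropicalization_power_map fin ks \<xi>)
  finally show "tropicalization (indices (dual \<sigma>)) (indices (mutate_seq ks (dual \<sigma>))) \<mu>_dual (\<psi> \<xi>) =
      \<psi>_mut (tropicalization (indices \<sigma>) (indices (mutate_seq ks \<sigma>)) \<mu> \<xi>)" .
qed

end
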